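(* Let $\mathscr{L}\text{-}\mathscr{P}_{\mathbb N}^+$ and the operator $S_4$ be as defined in the context. Then $S_4[\mathscr{L}\text{-}\mathscr{P}_{\mathbb N}^+]\subseteq \mathscr{L}\text{-}\mathscr{P}_{\mathbb N}^+\cup\{0\}$. That is, for every polynomial $\sum_{k=0}^n a_kx^k\in\mathscr{L}\text{-}\mathscr{P}_{\mathbb N}^+$, the polynomial $\sum_{k=0}^n (a_k^2-a_{k-4}a_{k+4})x^k$ (with $a_j=0$ for $j\notin\{0,1,\dots,n\}$) belongs to $\mathscr{L}\text{-}\mathscr{P}_{\mathbb N}^+\cup\{0\}$.
   Context: The Laguerre-Pólya class $\mathscr{L}\text{-}\mathscr{P}$ consists of the real entire functions that are limits, uniformly on compact subsets of $\mathbb C$, of real polynomials with only real zeros. $\mathscr{L}\text{-}\mathscr{P}^+$ is the subclass of those functions in $\mathscr{L}\text{-}\mathscr{P}$ with non-negative Taylor coefficients (at $0$). $\mathscr{L}\text{-}\mathscr{P}_{\mathbb N}^+ := \mathbb R[x]\cap\mathscr{L}\text{-}\mathscr{P}^+$, i.e. the real polynomials with non-negative coefficients all of whose zeros are real. For a sequence $\alpha=\{\alpha_k\}_{k=0}^\infty$ and a polynomial $\sum_{k=0}^n a_kx^k$, put $b_k(\alpha)=\sum_{j=0}^\infty \alpha_j a_{k-j}a_{k+j}$, where $a_j=0$ if $j\notin\{0,1,\dots,n\}$, and define the non-linear operator $U_\alpha\left(\sum_{k=0}^n a_kx^k\right)=\sum_{k=0}^n b_k(\alpha)x^k$. For a positive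 integer $r$, $S_r:=U_\alpha$ with $\alpha_0=1$, $\alpha_r=-1$ and $\alpha_k=0$ for $k\notin\{0,r\}$. Thus $S_r\left[\sum_{k=0}^n a_kx^k\right]=\sum_{k=0}^n (a_k^2-a_{k-r}a_{k+r})x^k$. *)

theory Defs
  imports "HOL-Complex_Analysis.Complex_Analysis" "HOL-Computational_Algebra.Computational_Algebra"
begin

abbreviation cpoly :: "real poly \<Rightarrow> complex \<Rightarrow> complex" where
  "cpoly p \<equiv> poly (map_poly of_real p)"

text \<open>The zeros are the complex ones, so nonzero constants qualify vacuously and the zero
  polynomial does not qualify.\<close>

definition only_real_zeros :: "real poly \<Rightarrow> bool" where
  "only_real_zeros p \<longleftrightarrow> (\<forall>z. cpoly p z = 0 \<longrightarrow> z \<in> \<real>)"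

text \<open>An entire function is real iff it maps the real axis into itself. The zero function
  belongs to the class, as the limit of the constants \<open>1 / Suc n\<close>.\<close>

definition Laguerre_Polya :: "(complex \<Rightarrow> complex) set" where
  "Laguerre_Polya = {f. f holomorphic_on UNIV \<and> (\<forall>x\<in>\<real>. f x \<in> \<real>) \<and>
     (\<exists>P :: nat \<Rightarrow> real poly. (\<forall>n. only_real_zeros (P n)) \<and>
        (\<forall>K. compact K \<longrightarrow> uniform_limit K (\<lambda>n. cpoly (P n)) f sequentially))}"

definition Laguerre_Polya_plus :: "(complex \<Rightarrow> complex) set" where
  "Laguerre_Polya_plus =
     {f \<in> Laguerre_Polya. \<forall>k. (deriv ^^ k) f 0 / fact k \<in> \<real>\<^sub>\<ge>\<^sub>0}"

definition Laguerre_Polya_plus_poly :: "real poly set" where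
  "Laguerre_Polya_plus_poly = {p. cpoly p \<in> Laguerre_Polya_plus}"

definition icoeff :: "'a::zero poly \<Rightarrow> int \<Rightarrow> 'a" where
  "icoeff p i = (if i < 0 then 0 else coeff p (nat i))"

text \<open>The series below is a finite sum: the terms with \<open>j > k\<close> vanish.\<close>

definition U_coeff :: "(nat \<Rightarrow> real) \<Rightarrow> real poly \<Rightarrow> nat \<Rightarrow> real" where
  "U_coeff \<alpha> p k = (\<Sum>j. \<alpha> j * icoeff p (int k - int j) * icoeff p (int k + int j))"

definition U_op :: "(nat \<Rightarrow> real) \<Rightarrow> real poly \<Rightarrow> real poly" where
  "U_op \<alpha> p = (\<Sum>k\<le>degree p. monom (U_coeff \<alpha> p k) k)"

text \<open>The operator \<open>S_op r\<close> is only meant for \<open>r > 0\<close>.\<close>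

definition S_op :: "nat \<Rightarrow> real poly \<Rightarrow> real poly" where
  "S_op r = U_op (\<lambda>k. if k = 0 then 1 else if k = r then -1 else 0)"

lemma U_coeff_finite:
  "U_coeff \<alpha> p k = (\<Sum>j\<le>k. \<alpha> j * coeff p (k - j) * coeff p (k + j))"
proof -
  have "U_coeff \<alpha> p k = (\<Sum>j\<le>k. \<alpha> j * icoeff p (int k - int j) * icoeff p (int k + int j))"
    unfolding U_coeff_def by (rule suminf_finite) (auto simp: icoeff_def)
  also have "\<dots> = (\<Sum>j\<le>k. \<alpha> j * coeff p (k - j) * coeff p (k + j))"
    by (rule sum.cong) (auto simp: icoeff_def nat_diff_distrib nat_add_distrib)
  finally show ?thesis .
qed

lemma coeff_U_op: "coeff (U_op \<alpha> p) k = U_coeff \<alpha> p k"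
proof -
  have "U_coeff \<alpha> p k = 0" if "k > degree p"
    unfolding U_coeff_finite using that by (intro sum.neutral) (auto simp: coeff_eq_0)
  then show ?thesis
    by (auto simp: U_op_def coeff_sum)
qed

lemma coeff_S_op:
  assumes "r > 0"
  shows "coeff (S_op r p) k =
    coeff p k ^ 2 - icoeff p (int k - int r) * icoeff p (int k + int r)"
proof -
  let ?\<alpha> = "\<lambda>k. if k = 0 then 1 else if k = r then -1 else (0::real)"
  have "U_coeff ?\<alpha> p k =
      (\<Sum>j\<in>{0,r}. ?\<alpha> j * icoeff p (int k - int j) * icoeff p (int k + int j))"
    unfolding U_coeff_def by (rule suminf_finite) auto
  then show ?thesis
    using assms by (simp add: S_op_def coeff_U_op icoeff_def power2_eq_square)
qed

lemma cpoly_of_real: "cpoly p (of_real x) = of_real (poly p x)"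
  by (induction p) (auto simp: map_poly_pCons)

lemma coeff_cpoly: "coeff (map_poly complex_of_real p) k = of_real (coeff p k)"
  by (simp add: coeff_map_poly)

lemma Taylor_coeff_poly: "(deriv ^^ k) (poly p) 0 / fact k = coeff p k"
  for p :: "complex poly"
proof -
  have "(deriv ^^ k) (poly p) = poly ((pderiv ^^ k) p)"
  proof (induction k)
    case (Suc k)
    have "deriv (poly q) = poly (pderiv q)" for q :: "complex poly"
      by (intro ext DERIV_imp_deriv poly_DERIV)
    with Suc show ?case by simp
  qed simp
  then show ?thesis
    by (simp add: poly_0_coeff_0 coeff_higher_pderiv flip: pochhammer_fact)
qed

lemma cpoly_cnj: "cpoly p (cnj z) = cnj (cpoly p z)"
  by (induction p) (auto simp: map_poly_pCons)

text \<open>By Hurwitz's theorem, the polynomials in the class are, besides 0, exactly those with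
  non-negative coefficients and only real zeros.\<close>

lemma Laguerre_Polya_plus_poly_eq:
  "Laguerre_Polya_plus_poly = {p. (\<forall>k. coeff p k \<ge> 0) \<and> only_real_zeros p} \<union> {0}"
proof -
  have plus: "p \<in> Laguerre_Polya_plus_poly \<longleftrightarrow> cpoly p \<in> Laguerre_Polya \<and> (\<forall>k. coeff p k \<ge> 0)" for p
    by (simp add: Laguerre_Polya_plus_poly_def Laguerre_Polya_plus_def Taylor_coeff_poly coeff_cpoly)
  have hol: "cpoly p holomorphic_on S" for p S
    by (intro holomorphic_intros)
  have real: "\<forall>x\<in>\<real>. cpoly p x \<in> \<real>" for p
    by (auto elim!: Reals_cases simp: cpoly_of_real)
  have 1: "cpoly p \<in> Laguerre_Polya" if "only_real_zeros p" for p
    unfolding Laguerre_Polya_def using that hol real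
    by (auto intro!: exI[of _ "\<lambda>_. p"] uniform_limit_const)
  have 2: "cpoly 0 \<in> Laguerre_Polya"
  proof -
    have "uniform_limit K (\<lambda>n. cpoly [:1 / real (Suc n):]) (cpoly 0) sequentially" for K
    proof -
      have "((\<lambda>n. complex_of_real (1 / real (Suc n))) \<longlongrightarrow> of_real 0) sequentially"
        by (intro tendsto_of_real) (use LIMSEQ_inverse_real_of_nat in \<open>simp add: inverse_eq_divide\<close>)
      then have "uniform_limit K (\<lambda>n z. complex_of_real (1 / real (Suc n))) (\<lambda>z. of_real 0) sequentially"
        by (auto simp: uniform_limit_iff tendsto_iff elim!: eventually_mono)
      moreover have "cpoly [:c:] = (\<lambda>z. of_real c)" "cpoly 0 = (\<lambda>z. of_real 0)" for c
        by (auto simp: fun_eq_iff map_poly_pCons)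
      ultimately show ?thesis
        by (simp only:)
    qed
    moreover have "only_real_zeros [:1 / real (Suc n):]" for n
      by (simp add: only_real_zeros_def map_poly_pCons del: of_nat_Suc)
    ultimately show ?thesis
      unfolding Laguerre_Polya_def using hol[of 0] real[of 0]
      by (auto intro!: exI[of _ "\<lambda>n. [:1 / real (Suc n):]"] simp del: of_nat_Suc map_poly_0 poly_0)
  qed
  have 3: "only_real_zeros p" if p: "cpoly p \<in> Laguerre_Polya" "p \<noteq> 0" for p
  proof (cases "degree p = 0")
    case True
    then obtain c where "p = [:c:]" by (rule degree_eq_zeroE)
    with p show ?thesis by (simp add: only_real_zeros_def map_poly_pCons)
  next
    case False
    obtain P where P: "\<And>n. only_real_zeros (P n)"
      and lim: "\<And>K. compact K \<Longrightarrow> uniform_limit K (\<lambda>n. cpoly (P n)) (cpoly p) sequentially"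
      using p unfolding Laguerre_Polya_def by blast
    have upper: "cpoly p z \<noteq> 0" if "Im z > 0" for z
    proof (rule Hurwitz_no_zeros[where S = "{z. Im z > 0}" and \<F> = "\<lambda>n. cpoly (P n)"
        and g = "cpoly p"])
      show "open {z. Im z > 0}" by (rule open_halfspace_Im_gt)
      show "connected {z. Im z > 0}"
        by (simp add: convex_halfspace_Im_gt convex_connected)
      show "\<not> cpoly p constant_on {z. Im z > 0}"
      proof
        assume "cpoly p constant_on {z. Im z > 0}"
        then obtain c where c: "\<And>z. Im z > 0 \<Longrightarrow> cpoly p z = c"
          unfolding constant_on_def by auto
        let ?q = "map_poly complex_of_real p - [:c:]"
        have "(\<lambda>n. \<i> * of_nat (Suc n)) ` UNIV \<subseteq> {z. poly ?q z = 0}"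
          using c by auto
        moreover have "infinite ((\<lambda>n. \<i> * of_nat (Suc n)) ` UNIV)"
          by (rule range_inj_infinite) (auto simp: inj_def simp del: of_nat_Suc)
        ultimately have "?q = 0"
          using poly_roots_finite infinite_super by blast
        then have "degree (map_poly complex_of_real p) = 0" by simp
        with False show False by (simp add: degree_map_poly)
      qed
      show "cpoly (P n) z \<noteq> 0" if "z \<in> {z. Im z > 0}" for n z
        using P[of n] that by (auto simp: only_real_zeros_def complex_is_Real_iff)
    qed (use lim hol that in auto)
    show ?thesis
      unfolding only_real_zeros_def
    proof (intro allI impI)
      fix z assume z: "cpoly p z = 0"
      then have "cpoly p (cnj z) = 0" by (simp add: cpoly_cnj)
      with z upper[of z] upper[of "cnj z"] show "z \<in> \<real>"
        by (force simp: complex_is_Real_iff not_less)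
    qed
  qed
  show ?thesis
    using 1 2 3 by (auto simp: plus)
qed

end

theory Submission
  imports Defs
begin

text \<open>
  Let \<open>P(x) = c \<Prod>(x + r)\<close> with all \<open>r \<ge> 0\<close>, let \<open>T\<close> be its image under the operator, and let
  \<open>y\<close> be a point of the open right half-plane. Comparing coefficients shows that \<open>T(y\<^sup>2)\<close> is
  the constant term in \<open>w\<close> of \<open>P(y w) P(y / w) (1 - w^8)\<close>. The product of the two values of
  \<open>P\<close> is a polynomial \<open>Q\<close> in \<open>t = w + 1 / w\<close>, and all zeros of \<open>Q\<close> lie in the open left
  half-plane. The functional that takes the constant term after multiplication by \<open>1 - w^8\<close>
  kills odd powers of \<open>t\<close> and sends \<open>t^(2 m)\<close> to \<open>(2 m choose m) - (2 m choose (m + 4))\<close>. With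
  \<open>\<theta> = z d/dz\<close>, this number is \<open>(2 m)! / 3\<close> times the coefficient of \<open>z^m\<close> in \<open>F = (2 \<theta> + 1)
  (\<theta>\<^sup>2 + \<theta> + 3) h\<close>, where \<open>h(z) = \<Sum> 24 z^m / (m! (m + 4)!)\<close> is a Bessel function of order 4 in
  disguise. Hence \<open>3 T(y\<^sup>2) = F(D\<^sup>2) Q\<close> at \<open>t = 0\<close>, with \<open>D = d/dt\<close>.

  Suppose that \<open>F\<close> were a polynomial with only negative zeros \<open>- s\<^sup>2\<close>. Then \<open>F(D\<^sup>2)\<close> would be
  a product of operators \<open>(D + i s) (D - i s)\<close>. Each of them preserves the absence of zeros in
  the closed right half-plane, because there the real part of \<open>Q' / Q\<close> is positive unless \<open>Q\<close>
  is constant. So \<open>T(y\<^sup>2) \<noteq> 0\<close> (\<open>even_pairing_nonzero\<close>). As \<open>y\<^sup>2\<close> covers the plane without the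
  half-line of nonpositive reals, \<open>T\<close> would have only real nonpositive zeros, and its leading
  coefficient is a square, so that its coefficients would be nonnegative. The function \<open>F\<close> is
  not a polynomial, so it is approximated by polynomials \<open>F\<^sub>N\<close> with only negative zeros, and
  Hurwitz's theorem in the variable \<open>y\<close> gives the result (\<open>S_op_4_nonvanishing\<close>).

  The core is the location of the zeros of \<open>F\<^sub>N\<close> (\<open>reduced_operator_zeros\<close>). The polynomial
  \<open>x\<^sup>2 + x + 3\<close> has no real zeros, and the operator \<open>\<theta>\<^sup>2 + \<theta> + 3\<close> does not preserve real
  zeros, as \<open>(1 + z)\<^sup>2\<close> shows; so a special property of \<open>h\<close> is essential. The equation \<open>\<theta> (\<theta> +
  4) h = z h\<close> reduces \<open>F\<close> to \<open>3 (1 - z) h + (2 z + 27) \<theta> h\<close>. In this expression \<open>h\<close> is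
  replaced by rescaled Laguerre polynomials \<open>g\<^sub>N = \<Prod>(1 + u z)\<close>, which have only negative zeros
  \<open>- 1 / u\<close>. Two facts about these zeros are enough: \<open>\<Sum> u = 1 / 5\<close>, and \<open>1 / u \<ge> 27 / 2\<close>,
  which puts them beyond the sign change of \<open>2 z + 27\<close>; the latter follows from the value of
  \<open>\<Sum> u^3\<close>. They make all residues of \<open>F\<^sub>N / ((z + 4) g\<^sub>N)\<close> nonpositive, and such a function
  maps the upper half-plane into itself, so that it has no zeros off the real line.
\<close>

section \<open>Products of linear factors\<close>

lemma factor_over_reals:
  fixes p :: "real poly"
  assumes "only_real_zeros p"
  shows "\<exists>rs. p = smult (lead_coeff p) (\<Prod>r\<leftarrow>rs. [:r, 1:]) \<and> length rs = degree p \<and>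
    (\<forall>r\<in>set rs. poly p (- r) = 0)"
  using assms
proof (induction "degree p" arbitrary: p)
  case 0
  then obtain c where "p = [:c:]" by (metis degree_eq_zeroE)
  then show ?case by (intro exI[of _ "[]"]) simp
next
  case (Suc n)
  have "degree (map_poly complex_of_real p) \<noteq> 0" using Suc(2) by (simp add: degree_map_poly)
  then obtain z where z: "cpoly p z = 0"
    using fundamental_theorem_of_algebra[of "map_poly complex_of_real p"] by (auto simp: constant_degree)
  with Suc.prems obtain x where x: "z = of_real x" by (auto simp: only_real_zeros_def elim: Reals_cases)
  with z have px: "poly p x = 0" by (simp add: cpoly_of_real)
  then obtain q where q: "p = [:- x, 1:] * q" by (auto simp: poly_eq_0_iff_dvd elim: dvdE)
  have "q \<noteq> 0" using Suc(2) q by auto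
  then have "degree p = Suc (degree q)" unfolding q by (subst degree_mult_eq) auto
  moreover have cp: "map_poly complex_of_real p = [:- of_real x, 1:] * map_poly of_real q"
    by (simp add: q poly_eq_iff coeff_map_poly coeff_pCons split: nat.splits)
  have "only_real_zeros q"
    using Suc.prems by (auto simp: only_real_zeros_def cp)
  ultimately obtain rs where rs: "q = smult (lead_coeff q) (\<Prod>r\<leftarrow>rs. [:r, 1:])" "length rs = degree q"
      "\<forall>r\<in>set rs. poly q (- r) = 0"
    using Suc by auto
  have "lead_coeff p = lead_coeff q" by (simp only: q lead_coeff_mult) simp
  then have "p = smult (lead_coeff p) (\<Prod>r\<leftarrow>(- x # rs). [:r, 1:])"
    using q rs(1) by (metis (no_types, lifting) list.simps(9) mult_smult_right prod_list.Cons)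
  moreover have "length (- x # rs) = degree p"
    using rs(2) \<open>degree p = Suc (degree q)\<close> by simp
  moreover have "poly p (- r) = 0" if "r \<in> set (- x # rs)" for r
    using that rs(3) px by (auto simp: q simp del: mult_pCons_left)
  ultimately show ?case by blast
qed

lemma of_real_linear_products:
  "map_poly complex_of_real (\<Prod>r\<leftarrow>rs. [:a r, b r:]) = (\<Prod>r\<leftarrow>rs. [:of_real (a r), of_real (b r):])"
proof (induction rs)
  case (Cons r rs)
  have "map_poly complex_of_real ([:a r, b r:] * q) = [:of_real (a r), of_real (b r):] * map_poly of_real q" for q
    by (simp add: poly_eq_iff coeff_map_poly coeff_pCons split: nat.splits)
  with Cons show ?case by (simp del: mult_pCons_left)
qed simp

lemma degree_linear_products: "degree (\<Prod>r\<leftarrow>rs. [:a r, b r:]) \<le> length rs"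
  for a b :: "'b \<Rightarrow> 'a::comm_ring_1"
proof (induction rs)
  case (Cons r rs)
  have "degree ([:a r, b r:] * (\<Prod>r\<leftarrow>rs. [:a r, b r:])) \<le> 1 + length rs"
    by (rule order.trans[OF degree_mult_le add_mono[OF _ Cons]]) (simp add: degree_pCons_eq_if)
  then show ?case by simp
qed simp

lemma coeff_0_linear_products: "coeff (\<Prod>u\<leftarrow>us. [:1, u:]) 0 = (1::'a::comm_ring_1)"
  by (induction us) (auto simp: coeff_mult)

lemma coeff_1_linear_products:
  "coeff (\<Prod>u\<leftarrow>us. [:1, u:]) 1 = (\<Sum>u\<leftarrow>us. u::'a::comm_ring_1)"
  by (induction us) (auto simp: coeff_0_linear_products coeff_pCons)

text \<open>
  Newton's identity for the third power sum; the coefficients of the product are the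
  elementary symmetric functions.
\<close>

lemma newton_cubes:
  fixes us :: "'a::comm_ring_1 list"
  defines "G \<equiv> \<Prod>u\<leftarrow>us. [:1, u:]"
  shows "(\<Sum>u\<leftarrow>us. u ^ 3) = coeff G 1 ^ 3 - 3 * coeff G 1 * coeff G 2 + 3 * coeff G 3"
  unfolding G_def
proof (induction us)
  case (Cons u us)
  define G where "G = (\<Prod>u\<leftarrow>us. [:1, u:])"
  have G0: "coeff G 0 = 1" unfolding G_def by (rule coeff_0_linear_products)
  have c: "coeff ([:1, u:] * G) (Suc k) = coeff G (Suc k) + u * coeff G k" for k
    by simp
  have "coeff ([:1, u:] * G) 1 = coeff G 1 + u" "coeff ([:1, u:] * G) 2 = coeff G 2 + u * coeff G 1"
     "coeff ([:1, u:] * G) 3 = coeff G 3 + u * coeff G 2"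
    using c[of 0] c[of 1] c[of 2] G0 by (simp_all add: numeral_2_eq_2 numeral_3_eq_3 del: mult_pCons_left)
  then show ?case using Cons
    by (simp add: power3_eq_cube algebra_simps flip: G_def)
qed (simp_all add: coeff_eq_0)

section \<open>First-order operators that preserve zero-free half-planes\<close>

text \<open>
  \<open>Q' / Q\<close> is the sum of \<open>1 / (z - w)\<close> over the zeros \<open>w\<close>, and inversion preserves the right
  half-plane. The value \<open>s = 0\<close> is the case of a constant \<open>Q\<close>.
\<close>

lemma log_derivative_in_half_plane:
  fixes Q :: "complex poly"
  assumes "\<And>w. poly Q w = 0 \<Longrightarrow> Re (a * (z - w)) > 0"
  shows "\<exists>s. poly (pderiv Q) z = s * poly Q z \<and> (s = 0 \<or> Re (s / a) > 0)"
  using assms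
proof (induction "degree Q" arbitrary: Q rule: less_induct)
  case less
  show ?case
  proof (cases "degree Q = 0")
    case True
    then have "pderiv Q = 0" by (simp add: pderiv_eq_0_iff)
    then show ?thesis by (intro exI[of _ 0]) simp
  next
    case False
    then obtain w where w: "poly Q w = 0"
      using fundamental_theorem_of_algebra[of Q] by (auto simp: constant_degree)
    then obtain R where Q: "Q = [:- w, 1:] * R"
      by (auto simp: poly_eq_0_iff_dvd elim: dvdE)
    have [simp]: "R \<noteq> 0" using False Q by auto
    have "degree R < degree Q" unfolding Q by (subst degree_mult_eq) auto
    moreover have "Re (a * (z - v)) > 0" if "poly R v = 0" for v
      using less.prems[of v] that Q by simp
    ultimately obtain s where s: "poly (pderiv R) z = s * poly R z" "s = 0 \<or> Re (s / a) > 0"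
      using less.hyps by blast
    have pos: "Re (a * (z - w)) > 0" using less.prems w by blast
    then have nz: "z \<noteq> w" "a \<noteq> 0" by auto
    have "Re (1 / (a * (z - w))) > 0"
      using pos by (auto simp: Re_divide simp del: times_complex.sel minus_complex.sel
          intro!: divide_pos_pos add_pos_nonneg)
    then have "Re ((1 / (z - w)) / a) > 0" by (simp add: mult.commute)
    then have sum: "Re ((s + 1 / (z - w)) / a) > 0"
      using s(2) by (auto simp: add_divide_distrib simp del: Re_divide_of_real)
    have dQ: "poly (pderiv Q) z = poly R z + (z - w) * poly (pderiv R) z"
      unfolding Q pderiv_mult by (simp add: pderiv_pCons algebra_simps)
    have "poly Q z = (z - w) * poly R z" by (simp add: Q algebra_simps)
    then have "poly (pderiv Q) z = (s + 1 / (z - w)) * poly Q z"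
      unfolding dQ s(1) using nz by (simp add: distrib_right)
    with sum show ?thesis by blast
  qed
qed

text \<open>
  The hypothesis on \<open>H\<close> is satisfied by open and by closed half-planes with inner normal
  direction \<open>cnj a\<close>. The Laguerre polynomials need the open ones, since they start from a
  power of the variable, whose zero lies on the boundary; the pairing below is evaluated at 0
  and needs a closed one.
\<close>

lemma deriv_plus_scalar_nonvanishing:
  fixes Q :: "complex poly"
  assumes H: "\<And>z w. z \<in> H \<Longrightarrow> w \<notin> H \<Longrightarrow> Re (a * (z - w)) > 0"
    and Q: "\<And>z. z \<in> H \<Longrightarrow> poly Q z \<noteq> 0"
    and b: "b \<noteq> 0" "Re (b / a) \<ge> 0" and z: "z \<in> H"
  shows "poly (pderiv Q + smult b Q) z \<noteq> 0"
proof
  assume *: "poly (pderiv Q + smult b Q) z = 0"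
  obtain s where s: "poly (pderiv Q) z = s * poly Q z" "s = 0 \<or> Re (s / a) > 0"
    using log_derivative_in_half_plane[of Q a z] H Q z by blast
  have "(s + b) * poly Q z = 0" using * s(1) by (simp add: algebra_simps)
  then have "s = - b" using Q[OF z] by (simp add: add_eq_0_iff2)
  with s(2) b show False by (auto simp: divide_minus_left)
qed

text \<open>
  This is the value at 0 of \<open>f(D\<^sup>2) Q\<close>, where \<open>D\<close> is differentiation. The explicit bound \<open>M\<close>
  on the range of summation stays fixed when linear factors are moved from \<open>f\<close> to \<open>Q\<close>.
\<close>

definition even_pairing :: "nat \<Rightarrow> complex poly \<Rightarrow> complex poly \<Rightarrow> complex" where
  "even_pairing M f Q = (\<Sum>k\<le>M. coeff f k * fact (2 * k) * coeff Q (2 * k))"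

lemma even_pairing_linear_factor:
  assumes "degree Q \<le> M"
  shows "even_pairing M ([:c, 1:] * f) Q = even_pairing M f (smult c Q + pderiv (pderiv Q))"
proof -
  have Q0: "coeff Q (2 * M + 2) = 0" using assms by (intro coeff_eq_0) simp
  have "(\<Sum>k\<le>M. coeff (pCons 0 f) k * fact (2 * k) * coeff Q (2 * k))
      = (\<Sum>k\<le>Suc M. coeff (pCons 0 f) k * fact (2 * k) * coeff Q (2 * k))"
    using Q0 by simp
  also have "\<dots> = (\<Sum>k\<le>M. coeff f k * fact (2 * k + 2) * coeff Q (2 * k + 2))"
    by (subst sum.atMost_Suc_shift) simp
  also have "\<dots> = (\<Sum>k\<le>M. coeff f k * fact (2 * k) * coeff (pderiv (pderiv Q)) (2 * k))"
    by (intro sum.cong refl) (simp add: coeff_pderiv algebra_simps)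
  finally show ?thesis
    by (simp add: even_pairing_def sum.distrib algebra_simps)
qed

text \<open>
  A zero \<open>- s\<^sup>2\<close> of \<open>f\<close> contributes the operator \<open>D\<^sup>2 + s\<^sup>2 = (D - i s) (D + i s)\<close>, and both
  factors preserve the absence of zeros in the closed right half-plane.
\<close>

lemma even_pairing_nonzero:
  assumes f: "f \<noteq> 0" "\<And>z. poly f z = 0 \<Longrightarrow> Im z = 0 \<and> Re z < 0"
    and Q: "degree Q \<le> M" "\<And>t. Re t \<ge> 0 \<Longrightarrow> poly Q t \<noteq> 0"
  shows "even_pairing M f Q \<noteq> 0"
  using assms
proof (induction "degree f" arbitrary: f Q rule: less_induct)
  case less
  show ?case
  proof (cases "degree f = 0")
    case True
    then obtain c where c: "f = [:c:]" "c \<noteq> 0" using less.prems(1) by (metis degree_eq_zeroE pCons_0_0)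
    have "even_pairing M f Q = (\<Sum>k\<in>{0}. coeff f k * fact (2 * k) * coeff Q (2 * k))"
      unfolding even_pairing_def using c by (intro sum.mono_neutral_right) (auto simp: coeff_pCons split: nat.splits)
    also have "\<dots> = c * poly Q 0" using c by (simp add: poly_0_coeff_0)
    finally show ?thesis using c less.prems(4)[of 0] by simp
  next
    case False
    then obtain w where w: "poly f w = 0"
      using fundamental_theorem_of_algebra[of f] by (auto simp: constant_degree)
    then obtain g where g: "f = [:- w, 1:] * g"
      by (auto simp: poly_eq_0_iff_dvd elim: dvdE)
    have [simp]: "g \<noteq> 0" using less.prems(1) g by auto
    have deg: "degree g < degree f" unfolding g by (subst degree_mult_eq) auto
    define s where "s = sqrt (- Re w)"
    have s: "s > 0" "s\<^sup>2 = - Re w" using less.prems(2)[OF w] by (auto simp: s_def)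
    have w': "w = - (of_real s)\<^sup>2"
      using less.prems(2)[OF w] s(2) by (auto simp: complex_eq_iff simp flip: of_real_power)
    define R where "R = pderiv Q + smult (\<i> * s) Q"
    have H: "Re (1 * (z - v)) > 0" if "z \<in> {z. Re z \<ge> 0}" "v \<notin> {z. Re z \<ge> 0}" for z v
      using that by simp
    have R: "poly R t \<noteq> 0" if "t \<in> {t. Re t \<ge> 0}" for t
      unfolding R_def
      by (rule deriv_plus_scalar_nonvanishing[OF H _ _ _ that]) (use less.prems(4) s in auto)
    have R2: "poly (pderiv R + smult (- \<i> * s) R) t \<noteq> 0" if "t \<in> {t. Re t \<ge> 0}" for t
      by (rule deriv_plus_scalar_nonvanishing[OF H R _ _ that]) (use s in auto)
    have eq: "pderiv R + smult (- \<i> * s) R = smult (- w) Q + pderiv (pderiv Q)"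
      by (intro poly_eqI)
        (simp add: R_def w' pderiv_add pderiv_smult power2_eq_square algebra_simps)
    have "degree (smult (- w) Q + pderiv (pderiv Q)) \<le> M"
      using less.prems(3) by (intro degree_add_le) (auto simp: degree_pderiv intro: order.trans[OF degree_smult_le])
    moreover have "poly (smult (- w) Q + pderiv (pderiv Q)) t \<noteq> 0" if "Re t \<ge> 0" for t
      using R2[of t] that unfolding eq by simp
    ultimately have "even_pairing M g (smult (- w) Q + pderiv (pderiv Q)) \<noteq> 0"
      using less.prems(2) g by (intro less.hyps[OF deg]) auto
    then show ?thesis
      unfolding g even_pairing_linear_factor[OF less.prems(3)] .
  qed
qed

section \<open>The reciprocal zeros of Laguerre polynomials\<close>

text \<open>
  The coefficients of \<open>(D + b)^N x^M\<close>. For \<open>M - k > N\<close> the binomial coefficient vanishes, so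
  the truncated exponent of \<open>b\<close> is harmless.
\<close>

lemma coeff_deriv_plus_scalar_power:
  fixes b :: "'a::{idom,ring_char_0}"
  shows "fact k * coeff (((\<lambda>Q. pderiv Q + smult b Q) ^^ N) (monom 1 M)) k =
    (if k \<le> M then of_nat (N choose (M - k)) * b ^ (N + k - M) * fact M else 0)"
proof (induction N arbitrary: k)
  case 0
  then show ?case by auto
next
  case (Suc N)
  let ?c = "coeff (((\<lambda>Q. pderiv Q + smult b Q) ^^ N) (monom 1 M))"
  have "fact k * coeff (((\<lambda>Q. pderiv Q + smult b Q) ^^ Suc N) (monom 1 M)) k
      = fact (Suc k) * ?c (Suc k) + b * (fact k * ?c k)"
    by (simp add: coeff_pderiv algebra_simps)
  also have "\<dots> = (if k \<le> M then of_nat (Suc N choose (M - k)) * b ^ (Suc N + k - M) * fact M else 0)"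
  proof (cases "k < M")
    case True
    then obtain d where d: "M = Suc (k + d)" using less_iff_Suc_add by auto
    show ?thesis
    proof (cases "d < N")
      case True
      then have "Suc N + k - M = Suc (N + k - M)" "N - d = Suc (N - Suc d)" using d by auto
      then show ?thesis using d unfolding Suc by (simp add: algebra_simps Suc_diff_le)
    next
      case False
      then show ?thesis using d unfolding Suc by (cases "d = N") (auto simp: binomial_eq_0)
    qed
  next
    case False
    then show ?thesis unfolding Suc by (auto simp: algebra_simps)
  qed
  finally show ?case .
qed

text \<open>
  These are the coefficients of the Laguerre polynomial \<open>L\<^sub>N\<close> with parameter 4, evaluated at
  \<open>- z / N\<close> and normalized to the value 1 at 0.
\<close>

definition laguerre_coeff :: "nat \<Rightarrow> nat \<Rightarrow> real" where
  "laguerre_coeff N m = real (N choose m) / real N ^ m * (24 / fact (m + 4))"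

text \<open>
  This is Rodrigues' formula: up to a constant factor, \<open>(D + 1 / N)^N x^(N + 4)\<close> equals \<open>x^4\<close>
  times the Laguerre polynomial, and \<open>D + 1 / N\<close> preserves the absence of zeros in both open
  half-planes bounded by the real line.
\<close>

lemma laguerre_factorization:
  assumes N: "N > 0"
  shows "\<exists>us. (\<forall>u\<in>set us. u > 0) \<and> (\<forall>m. coeff (\<Prod>u\<leftarrow>us. [:1, u:]) m = laguerre_coeff N m)"
proof -
  define D where "D = (\<lambda>Q. pderiv Q + smult (1 / of_nat N :: complex) Q)"
  define W where "W = (D ^^ N) (monom 1 (N + 4))"
  \<comment> \<open>The half-planes in question are given by \<open>a = - i\<close> (upper) and \<open>a = i\<close> (lower).\<close>
  have half: "poly ((D ^^ k) (monom 1 (N + 4))) z \<noteq> 0"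
    if "Re (a * z) > 0" "Re (1 / a) = 0" for k a z
    using that(1)
  proof (induction k arbitrary: z)
    case 0
    then show ?case by (auto simp: poly_monom)
  next
    case (Suc k)
    have "Re (1 / of_nat N / a) = Re (1 / a) / N"
      by (simp only: divide_divide_eq_left mult.commute[of "of_nat N"] flip: Re_divide_of_nat)
    then show ?case unfolding funpow.simps o_def D_def
      using Suc N that(2) by (intro deriv_plus_scalar_nonvanishing[where H = "{z. Re (a * z) > 0}" and a = a])
        (auto simp: algebra_simps D_def[symmetric])
  qed
  have W: "Im z = 0" if "poly W z = 0" for z
    using half[of "-\<i>" z N] half[of "\<i>" z N] that unfolding W_def
    by (cases "Im z" "0 :: real" rule: linorder_cases) auto
  define G where "G = (\<Sum>m\<le>N. monom (laguerre_coeff N m) m)"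
  have G: "coeff G m = laguerre_coeff N m" for m
    by (auto simp: G_def coeff_sum laguerre_coeff_def binomial_eq_0)
  have WG: "W = smult (fact (N + 4) / 24) (monom 1 4 * map_poly of_real G)"
  proof (rule poly_eqI)
    fix k
    have "fact k * coeff W k = (if k \<le> N + 4 then of_nat (N choose (N + 4 - k))
        * (1 / of_nat N) ^ (N + k - (N + 4)) * fact (N + 4) else (0::complex))"
      unfolding W_def D_def by (rule coeff_deriv_plus_scalar_power)
    also have "\<dots> = fact k * coeff (smult (fact (N + 4) / 24) (monom 1 4 * map_poly of_real G)) k"
    proof (cases "k < 4")
      case True
      then show ?thesis by (simp add: binomial_eq_0 coeff_monom_mult)
    next
      case False
      then obtain j where j: "k = j + 4" by (metis add.commute le_Suc_ex not_less)
      have "N choose (N - j) = (if j \<le> N then N choose j else 1)"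
        by (auto intro: binomial_symmetric[symmetric])
      then show ?thesis
        by (auto simp: j coeff_monom_mult coeff_map_poly G laguerre_coeff_def power_divide binomial_eq_0)
    qed
    finally show "coeff W k = coeff (smult (fact (N + 4) / 24) (monom 1 4 * map_poly of_real G)) k"
      by simp
  qed
  have "only_real_zeros G"
    unfolding only_real_zeros_def using W by (auto simp: WG complex_is_Real_iff)
  then obtain rs where rs: "G = smult (lead_coeff G) (\<Prod>r\<leftarrow>rs. [:r, 1:])"
      "\<forall>r\<in>set rs. poly G (- r) = 0"
    using factor_over_reals by blast
  have pos: "poly G x > 0" if "x \<ge> 0" for x
  proof -
    have "poly G x = (\<Sum>m\<le>N. laguerre_coeff N m * x ^ m)" by (simp add: G_def poly_sum poly_monom)
    also have "\<dots> \<ge> (\<Sum>m\<in>{0}. laguerre_coeff N m * x ^ m)"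
      using that by (intro sum_mono2) (auto simp: laguerre_coeff_def)
    finally show ?thesis by (simp add: laguerre_coeff_def fact_numeral)
  qed
  have rpos: "r > 0" if "r \<in> set rs" for r using pos[of "- r"] rs(2) that by fastforce
  have prod: "(\<Prod>r\<leftarrow>rs. [:r, 1:]) = smult (\<Prod>r\<leftarrow>rs. r) (\<Prod>u\<leftarrow>map (\<lambda>r. 1 / r) rs. [:1, u:])"
    using rpos by (induction rs) (auto simp: mult_smult_left[symmetric] simp del: mult_pCons_left mult_smult_left)
  define c where "c = lead_coeff G * (\<Prod>r\<leftarrow>rs. r)"
  have c: "G = smult c (\<Prod>u\<leftarrow>map (\<lambda>r. 1 / r) rs. [:1, u:])"
    unfolding c_def smult_smult[symmetric] prod[symmetric] by (rule rs(1))
  have "c = coeff G 0" unfolding c coeff_smult coeff_0_linear_products by simp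
  then have "c = 1" unfolding G by (simp add: laguerre_coeff_def fact_numeral)
  with c have "G = (\<Prod>u\<leftarrow>map (\<lambda>r. 1 / r) rs. [:1, u:])" by simp
  then show ?thesis
    using rpos G by (intro exI[of _ "map (\<lambda>r. 1 / r) rs"]) (auto simp del: map_map)
qed

text \<open>
  The sum of the cubes tends to \<open>1 / 2625\<close>, which is less than \<open>(2 / 27)^3 = 8 / 19683\<close>; each
  single \<open>u^3\<close> is bounded by this sum. From 200 on, \<open>N\<close> is large enough for the error terms.
  The sum of the squares would not do: its limit \<open>1 / 150\<close> exceeds \<open>(2 / 27)\<^sup>2\<close>.
\<close>

lemma laguerre_reciprocal_zeros:
  assumes N: "N \<ge> 200"
  shows "\<exists>us. (\<forall>u\<in>set us. 0 < u \<and> u \<le> 2 / 27) \<and> (\<Sum>u\<leftarrow>us. u) = 1 / 5 \<and>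
    (\<forall>m. coeff (\<Prod>u\<leftarrow>us. [:1, u:]) m = laguerre_coeff N m)"
proof -
  obtain us where us: "\<forall>u\<in>set us. u > 0" "\<And>m. coeff (\<Prod>u\<leftarrow>us. [:1, u:]) m = laguerre_coeff N m"
    using laguerre_factorization[of N] N by auto
  define e where "e = 1 / real N"
  have e: "0 < e" "e \<le> 1 / 200" using N by (auto simp: e_def field_simps)
  have c1: "laguerre_coeff N 1 = 1 / 5"
    using N by (simp add: laguerre_coeff_def fact_numeral)
  have "real (N choose 2) = real N * (real N - 1) / 2"
    using N by (simp add: binomial_gbinomial gbinomial_prod_rev numeral_2_eq_2 field_simps)
  then have c2: "laguerre_coeff N 2 = (1 - e) / 60"
    using N by (simp add: laguerre_coeff_def fact_numeral e_def field_simps power2_eq_square)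
  have "real (N choose 3) = real N * (real N - 1) * (real N - 2) / 6"
    using N by (simp add: binomial_gbinomial gbinomial_prod_rev numeral_3_eq_3 fact_numeral field_simps)
  then have c3: "laguerre_coeff N 3 = (1 - e) * (1 - 2 * e) / 1260"
    using N by (simp add: laguerre_coeff_def fact_numeral e_def field_simps power3_eq_cube)
  have "(\<Sum>u\<leftarrow>us. u ^ 3) = (1 / 5) ^ 3 - 3 * (1 / 5) * ((1 - e) / 60) + 3 * ((1 - e) * (1 - 2 * e) / 1260)"
    using newton_cubes[of us] by (simp only: us c1 c2 c3)
  also have "\<dots> = 1 / 2625 + e / 350 + e * e / 210"
    by (simp add: field_simps power3_eq_cube)
  also have "\<dots> \<le> (2 / 27) ^ 3"
  proof -
    have "e * e \<le> 1 / 200 * (1 / 200)" using e by (intro mult_mono) auto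
    with e(2) show ?thesis by (simp add: power3_eq_cube)
  qed
  finally have cubes: "(\<Sum>u\<leftarrow>us. u ^ 3) \<le> (2 / 27) ^ 3" .
  have "u \<le> 2 / 27" if "u \<in> set us" for u
  proof -
    have "u ^ 3 \<le> (\<Sum>u\<leftarrow>us. u ^ 3)"
      using us(1) that by (intro member_le_sum_list) auto
    with cubes have "u ^ 3 \<le> (2 / 27) ^ 3" by simp
    then show ?thesis using power_le_imp_le_base[of u 2 "2 / 27"] by (simp add: numeral_3_eq_3)
  qed
  moreover have "(\<Sum>u\<leftarrow>us. u) = 1 / 5"
    using coeff_1_linear_products[of us] us(2)[of 1] c1 by simp
  ultimately show ?thesis using us by blast
qed

section \<open>Zeros of the reduced third-order operator\<close>

text \<open>
  With \<open>\<theta> = z d/dz\<close>, this is \<open>3 (1 - z) g + (2 z + 27) \<theta> g\<close>. On solutions of \<open>\<theta> (\<theta> + 4) g = z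
  g\<close> it agrees with the third-order operator \<open>(2 \<theta> + 1) (\<theta>\<^sup>2 + \<theta> + 3)\<close>.
\<close>

definition reduced_operator :: "complex poly \<Rightarrow> complex poly" where
  "reduced_operator g = [:3, -3:] * g + [:0, 27, 2:] * pderiv g"

text \<open>
  The contribution of the factor \<open>1 + u z\<close> of \<open>g\<close> to \<open>reduced_operator g / g\<close>. The condition
  \<open>\<Sum> u = 1 / 5\<close> allows to distribute \<open>3 (1 - z) = \<Sum> 15 u (1 - z)\<close> over the factors.
\<close>

definition quotient_term :: "real \<Rightarrow> complex \<Rightarrow> complex" where
  "quotient_term u z = of_real u * (15 + of_real (12 + 15 * u) * z + of_real (2 - 15 * u) * z\<^sup>2) /
     (1 + of_real u * z)"

text \<open>
  The undivided term is a linear function of positive slope plus a fraction that has, because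
  of \<open>27 u \<le> 2\<close>, a nonnegative residue at \<open>- 1 / u\<close>; their imaginary parts compete. A divisor
  that vanishes to the right of the pole changes the sign of this residue. It adds a pole of
  its own, and \<open>- 4\<close> is a place where the term is negative for all \<open>u\<close> in question, so that
  the new residue is negative as well.
\<close>

lemma quotient_term_half_plane:
  assumes u: "0 < u" "u \<le> 2 / 27" and z: "Im z \<noteq> 0"
  shows "Im (quotient_term u z / (z + 4)) * Im z > 0"
proof -
  define A where "A = u * (1 + 300 * u) / (1 - 4 * u)"
  define B where "B = (2 - 27 * u) / (1 - 4 * u)"
  have A: "A > 0" "B \<ge> 0" using u unfolding A_def B_def by (auto intro!: divide_pos_pos divide_nonneg_pos)
  have nz: "1 + of_real u * z \<noteq> 0" "z + 4 \<noteq> 0" "1 - 4 * u \<noteq> 0" "1 - 4 * complex_of_real u \<noteq> 0"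
    using u z by (auto simp: complex_eq_iff)
  have eq: "quotient_term u z / (z + 4)
      = of_real (2 - 15 * u) - of_real A * (1 / (z + 4)) - of_real B * (1 / (1 + of_real u * z))"
    unfolding A_def B_def quotient_term_def using nz
    by (simp add: divide_simps) (simp add: algebra_simps power2_eq_square)
  have "Im (1 / (z + 4)) * Im z < 0"
    using nz z by (simp add: Im_divide complex_neq_0 divide_neg_pos flip: power2_eq_square)
  then have "A * (Im (1 / (z + 4)) * Im z) < 0" using A by (simp only: mult_pos_neg)
  moreover have "Im (1 / (1 + of_real u * z)) * Im z \<le> 0"
  proof -
    have "Im (1 / (1 + of_real u * z)) * Im z
        = - u * (Im z)\<^sup>2 / ((Re (1 + of_real u * z))\<^sup>2 + (Im (1 + of_real u * z))\<^sup>2)"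
      by (simp add: Im_divide power2_eq_square)
    also have "\<dots> \<le> 0" using u by (intro divide_nonpos_nonneg) auto
    finally show ?thesis .
  qed
  then have "B * (Im (1 / (1 + of_real u * z)) * Im z) \<le> 0" using A by (simp only: mult_nonneg_nonpos)
  ultimately have *: "- (A * (Im (1 / (z + 4)) * Im z)) - B * (Im (1 / (1 + of_real u * z)) * Im z) > 0"
    by linarith
  have "Im (of_real c - of_real A * v - of_real B * w) * Im z
      = - (A * (Im v * Im z)) - B * (Im w * Im z)" for c v w
    by (simp add: algebra_simps)
  with * show ?thesis unfolding eq by (simp only:)
qed

lemma quotient_term_nonneg_real:
  assumes u: "0 < u" "u \<le> 2 / 27" and x: "x \<ge> 0"
  shows "Re (quotient_term u (of_real x)) > 0"
proof -
  have "quotient_term u (of_real x)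
      = of_real (u * (15 + (12 + 15 * u) * x + (2 - 15 * u) * x\<^sup>2) / (1 + u * x))"
    by (simp add: quotient_term_def)
  moreover have "u * (15 + (12 + 15 * u) * x + (2 - 15 * u) * x\<^sup>2) / (1 + u * x) > 0"
    using u x by (intro divide_pos_pos mult_pos_pos add_pos_nonneg) auto
  ultimately show ?thesis by (simp only: Re_complex_of_real)
qed

lemma reduced_operator_quotient:
  fixes us :: "real list" and z :: complex
  defines "g \<equiv> \<Prod>u\<leftarrow>us. [:1, complex_of_real u:]"
  assumes sum: "(\<Sum>u\<leftarrow>us. u) = 1 / 5" and nz: "\<And>u. u \<in> set us \<Longrightarrow> 1 + of_real u * z \<noteq> 0"
  shows "poly (reduced_operator g) z = poly g z * (\<Sum>u\<leftarrow>us. quotient_term u z)"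
proof -
  have "poly (pderiv g) z = poly g z * (\<Sum>u\<leftarrow>us. of_real u / (1 + of_real u * z))"
    using nz unfolding g_def
    by (induction us) (auto simp: pderiv_mult pderiv_pCons field_simps simp del: mult_pCons_left)
  then have "poly (reduced_operator g) z
      = poly g z * (3 * (1 - z) + (2 * z + 27) * z * (\<Sum>u\<leftarrow>us. of_real u / (1 + of_real u * z)))"
    by (simp add: reduced_operator_def algebra_simps)
  also have "3 * (1 - z) = 15 * (1 - z) * of_real (\<Sum>u\<leftarrow>us. u)"
    by (simp only: sum) simp
  also have "\<dots> + (2 * z + 27) * z * (\<Sum>u\<leftarrow>us. of_real u / (1 + of_real u * z))
     = (\<Sum>u\<leftarrow>us. quotient_term u z)"
    using nz
  proof (induction us)
    case (Cons u us)
    have "15 * (1 - z) * of_real u + (2 * z + 27) * z * (of_real u / (1 + of_real u * z)) = quotient_term u z"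
      using Cons.prems[of u]
      by (simp add: quotient_term_def divide_simps) (simp add: algebra_simps power2_eq_square)
    with Cons show ?case by (simp add: algebra_simps)
  qed simp
  finally show ?thesis .
qed

text \<open>
  Off the real line, the quotient divided by \<open>z + 4\<close> is a sum of terms whose imaginary parts
  have the sign of \<open>Im z\<close>; on the nonnegative half-line, the quotient is a sum of positive
  terms.
\<close>

lemma reduced_operator_zeros:
  fixes us :: "real list"
  defines "g \<equiv> \<Prod>u\<leftarrow>us. [:1, complex_of_real u:]"
  assumes us: "\<And>u. u \<in> set us \<Longrightarrow> 0 < u \<and> u \<le> 2 / 27" and sum: "(\<Sum>u\<leftarrow>us. u) = 1 / 5"
    and root: "poly (reduced_operator g) z = 0"
  shows "Im z = 0 \<and> Re z < 0"
proof (rule ccontr)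
  assume z: "\<not> (Im z = 0 \<and> Re z < 0)"
  have nz: "1 + of_real u * z \<noteq> 0" if "u \<in> set us" for u
  proof
    assume "1 + of_real u * z = 0"
    then have "u * Re z = -1" "u * Im z = 0" by (auto simp: complex_eq_iff)
    with us[OF that] z show False
      using mult_nonneg_nonneg[of u "Re z"] by (auto simp: not_less)
  qed
  have "poly g z \<noteq> 0"
    using nz unfolding g_def by (induction us) (auto simp: mult.commute simp del: mult_pCons_left)
  then have 0: "(\<Sum>u\<leftarrow>us. quotient_term u z) = 0"
    using root reduced_operator_quotient[OF sum nz] by (simp add: g_def)
  have ne: "us \<noteq> []" using sum by auto
  have sum_pos: "(\<Sum>u\<leftarrow>us. f u) > 0" if "\<And>u. u \<in> set us \<Longrightarrow> f u > 0" for f :: "real \<Rightarrow> real"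
    using ne that by (induction us rule: list_nonempty_induct) (auto intro: add_pos_pos)
  show False
  proof (cases "Im z = 0")
    case False
    have "0 = Im ((\<Sum>u\<leftarrow>us. quotient_term u z) / (z + 4)) * Im z" using 0 by simp
    also have "\<dots> = (\<Sum>u\<leftarrow>us. Im (quotient_term u z / (z + 4)) * Im z)"
      by (induction us) (auto simp: add_divide_distrib algebra_simps simp del: Im_divide)
    also have "\<dots> > 0"
      using us quotient_term_half_plane False by (intro sum_pos) auto
    finally show False by simp
  next
    case True
    then obtain x where x: "z = of_real x" "x \<ge> 0" using z by (cases z) (auto simp: complex_eq_iff)
    have "0 = Re (\<Sum>u\<leftarrow>us. quotient_term u z)" using 0 by simp
    also have "\<dots> = (\<Sum>u\<leftarrow>us. Re (quotient_term u z))" by (induction us) auto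
    also have "\<dots> > 0" using us quotient_term_nonneg_real x by (intro sum_pos) auto
    finally show False by simp
  qed
qed

section \<open>Convergence to differences of binomial coefficients\<close>

lemma uniform_limit_linear_combination:
  fixes c :: "nat \<Rightarrow> nat \<Rightarrow> 'b::real_normed_algebra" and f :: "nat \<Rightarrow> 'a::topological_space \<Rightarrow> 'b"
  assumes c: "\<And>m. (\<lambda>N. c N m) \<longlonglongrightarrow> l m" and K: "compact K" and f: "\<And>m. continuous_on K (f m)"
  shows "uniform_limit K (\<lambda>N y. \<Sum>m\<le>n. c N m * f m y) (\<lambda>y. \<Sum>m\<le>n. l m * f m y) sequentially"
proof -
  have single: "uniform_limit K (\<lambda>N y. c N m * f m y) (\<lambda>y. l m * f m y) sequentially" for m
  proof (rule uniform_lim_mult)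
    show "uniform_limit K (\<lambda>N y. c N m) (\<lambda>y. l m) sequentially"
      using c[of m] by (auto simp: uniform_limit_iff tendsto_iff elim!: eventually_mono)
    show "uniform_limit K (\<lambda>N. f m) (f m) sequentially" by (rule uniform_limit_const)
    show "bounded ((\<lambda>y. l m) ` K)" by (rule bounded_subset[of "{l m}"]) auto
    show "bounded (f m ` K)" by (intro compact_imp_bounded compact_continuous_image f K)
  qed
  show ?thesis
  proof (induction n)
    case 0
    then show ?case using single[of 0] by simp
  next
    case (Suc n)
    then show ?case by (simp add: uniform_limit_add single)
  qed
qed

lemma laguerre_coeff_tendsto: "(\<lambda>N. laguerre_coeff N m) \<longlonglongrightarrow> 24 / (fact m * fact (m + 4))"
proof -
  have "(\<lambda>N. real (N choose m) / real N ^ m) \<longlonglongrightarrow> 1 / fact m"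
  proof (induction m)
    case (Suc m)
    have "(\<lambda>N. (real N - real m) / real N) \<longlonglongrightarrow> 1" by real_asymp
    then have "(\<lambda>N. real (N choose m) / real N ^ m * ((real N - real m) / real N) / real (Suc m))
        \<longlonglongrightarrow> 1 / fact m * 1 / real (Suc m)"
      by (intro tendsto_intros Suc) auto
    moreover have "real (N choose m) / real N ^ m * ((real N - real m) / real N) / real (Suc m)
        = real (N choose Suc m) / real N ^ Suc m" for N
    proof -
      have "real (Suc m) * real (N choose Suc m) = real (N choose m) * (real N - real m)"
        using gbinomial_mult_1[of "real N" m] by (simp add: binomial_gbinomial algebra_simps)
      then have "real (N choose Suc m) = real (N choose m) * (real N - real m) / real (Suc m)"
        by (simp add: field_simps del: of_nat_Suc)
      then show ?thesis by (simp del: of_nat_Suc)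
    qed
    ultimately show ?case by (simp add: mult.commute)
  qed simp
  then have "(\<lambda>N. laguerre_coeff N m) \<longlonglongrightarrow> 1 / fact m * (24 / fact (m + 4))"
    unfolding laguerre_coeff_def by (rule tendsto_mult[OF _ tendsto_const])
  then show ?thesis by simp
qed

text \<open>
  The right-hand side comes from \<open>(m + 4) (m + 3) (m + 2) (m + 1) - m (m - 1) (m - 2) (m - 3)
  = 8 (2 m + 1) (m\<^sup>2 + m + 3)\<close>. The second product also accounts for the binomial coefficients
  that vanish for \<open>m < 4\<close>.
\<close>

lemma central_binomial_difference:
  "real (2 * m choose m) - real (2 * m choose (m + 4))
     = (2 * real m + 1) * (real m ^ 2 + real m + 3) * (8 / (fact m * fact (m + 4))) * fact (2 * m)"
proof -
  define x where "x = real m"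
  have F4: "fact (m + 4) = (x + 4) * (x + 3) * (x + 2) * (x + 1) * fact m"
    by (simp add: x_def numeral_eq_Suc algebra_simps)
  have 1: "real (2 * m choose m) = fact (2 * m) / (fact m * fact m)"
    by (subst binomial_fact) auto
  have 2: "real (2 * m choose (m + 4)) = fact (2 * m) / (fact m * fact (m + 4)) * (x * (x - 1) * (x - 2) * (x - 3))"
  proof (cases "m < 4")
    case True
    then have "m = 0 \<or> m = 1 \<or> m = 2 \<or> m = 3" by auto
    then have "x * (x - 1) * (x - 2) * (x - 3) = 0" by (auto simp: x_def)
    with True show ?thesis by (simp add: binomial_eq_0)
  next
    case False
    then obtain k where k: "m = k + 4" by (metis add.commute le_Suc_ex not_less)
    have "fact m = x * (x - 1) * (x - 2) * (x - 3) * fact k"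
      by (simp add: x_def k numeral_eq_Suc algebra_simps)
    moreover have "real (2 * m choose (m + 4)) = fact (2 * m) / (fact (m + 4) * fact k)"
      by (subst binomial_fact) (auto simp: k)
    moreover have "x * (x - 1) * (x - 2) * (x - 3) \<noteq> 0" by (auto simp: x_def k)
    ultimately show ?thesis by (simp del: mult_eq_0_iff)
  qed
  have "(x + 4) * (x + 3) * (x + 2) * (x + 1) \<noteq> 0" by (auto simp: x_def)
  then have 3: "1 / (fact m * fact m) = (x + 4) * (x + 3) * (x + 2) * (x + 1) / (fact m * fact (m + 4))"
    unfolding F4 by (simp del: mult_eq_0_iff)
  have "real (2 * m choose m) - real (2 * m choose (m + 4))
      = fact (2 * m) / (fact m * fact (m + 4)) *
        ((x + 4) * (x + 3) * (x + 2) * (x + 1) - x * (x - 1) * (x - 2) * (x - 3))"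
    using arg_cong[OF 3, of "(*) (fact (2 * m))"] by (simp add: 1 2 right_diff_distrib)
  also have "(x + 4) * (x + 3) * (x + 2) * (x + 1) - x * (x - 1) * (x - 2) * (x - 3)
      = 8 * ((2 * x + 1) * (x ^ 2 + x + 3))"
    by (simp add: algebra_simps power2_eq_square)
  finally show ?thesis by (simp add: x_def)
qed

lemma reduced_operator_coeff_tendsto:
  assumes g: "\<And>m. (\<lambda>N. coeff (g N) m) \<longlonglongrightarrow> complex_of_real (24 / (fact m * fact (m + 4)))"
  shows "(\<lambda>N. coeff (reduced_operator (g N)) m * fact (2 * m)) \<longlonglongrightarrow>
    3 * (of_nat (2 * m choose m) - of_nat (2 * m choose (m + 4)))"
proof -
  define h where "h m = complex_of_real (24 / (fact m * fact (m + 4)))" for m :: nat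
  have lim: "(\<lambda>N. coeff (g N) m) \<longlonglongrightarrow> h m" for m
    unfolding h_def by (rule g)
  have val: "3 * (of_nat (2 * m choose m) - of_nat (2 * m choose (m + 4)))
     = (2 * of_nat m + 1) * (of_nat m ^ 2 + of_nat m + 3) * h m * fact (2 * m)"
    using arg_cong[OF central_binomial_difference[of m], of "\<lambda>x. complex_of_real (3 * x)"]
    by (simp add: h_def)
  show ?thesis
  proof (cases m)
    case 0
    then show ?thesis unfolding val using tendsto_mult[OF lim[of 0] tendsto_const[of 3]]
      by (simp add: reduced_operator_def mult.commute)
  next
    case (Suc k)
    have c: "coeff (reduced_operator (g N)) m = 3 * coeff (g N) m - 3 * coeff (g N) k
        + 27 * of_nat m * coeff (g N) m + 2 * of_nat k * coeff (g N) k" for N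
      by (cases k) (simp_all add: reduced_operator_def Suc coeff_pderiv algebra_simps)
    \<comment> \<open>This is the coefficient form of \<open>\<theta> (\<theta> + 4) h = z h\<close>.\<close>
    have hk: "h k = of_nat m * (of_nat m + 4) * h m"
    proof -
      have "fact m = real m * fact k" "fact (m + 4) = (real m + 4) * fact (k + 4)"
        using fact_Suc[of "k + 4", where 'a = real] by (simp_all add: Suc algebra_simps)
      moreover have "real m \<noteq> 0" "real m + 4 \<noteq> 0" by (simp_all add: Suc)
      ultimately have eq: "24 / (fact k * fact (k + 4)) = real m * (real m + 4) * (24 / (fact m * fact (m + 4)))"
        by (simp add: divide_simps)
      show ?thesis
        unfolding h_def by (simp only: eq of_real_mult of_real_add of_real_numeral of_real_of_nat_eq)
    qed
    have "(\<lambda>N. coeff (reduced_operator (g N)) m * fact (2 * m)) \<longlonglongrightarrow>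
      (3 * h m - 3 * h k + 27 * of_nat m * h m + 2 * of_nat k * h k) * fact (2 * m)"
      unfolding c by (intro tendsto_intros lim)
    also have "3 * h m - 3 * h k + 27 * of_nat m * h m + 2 * of_nat k * h k
      = (2 * of_nat m + 1) * (of_nat m ^ 2 + of_nat m + 3) * h m"
      unfolding hk Suc by (simp add: algebra_simps power2_eq_square)
    finally show ?thesis unfolding val .
  qed
qed

section \<open>The operator as a constant term\<close>

lemma coeff_one_plus_square_power:
  "coeff ([:1, 0, 1:] ^ k :: 'a::comm_ring_1 poly) j = (if even j then of_nat (k choose (j div 2)) else 0)"
proof (induction k arbitrary: j)
  case 0
  then show ?case by (cases j) auto
next
  case (Suc k)
  have "coeff ([:1, 0, 1:] ^ Suc k :: 'a poly) j = coeff ([:1, 0, 1:] ^ k) j + 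
      (if j \<ge> 2 then coeff ([:1, 0, 1:] ^ k) (j - 2) else 0)"
    by (cases j rule: nat.exhaust; cases "j - 1") (auto simp: algebra_simps)
  moreover have "\<exists>i. j div 2 = Suc i \<and> (j - 2) div 2 = i" if "j \<ge> 2"
    using that by (intro exI[of _ "j div 2 - 1"]) auto
  ultimately show ?case by (cases "j \<ge> 2") (auto simp: Suc algebra_simps)
qed

lemma poly_eqI_nonzero:
  fixes p q :: "complex poly"
  assumes "\<And>w. w \<noteq> 0 \<Longrightarrow> poly p w = poly q w"
  shows "p = q"
proof (rule ccontr)
  assume "p \<noteq> q"
  then have "finite {w. poly (p - q) w = 0}" by (intro poly_roots_finite) simp
  moreover have "UNIV - {0} \<subseteq> {w. poly (p - q) w = 0}" using assms by auto
  ultimately have "finite (UNIV - {0 :: complex})" by (rule finite_subset[rotated])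
  then show False using infinite_UNIV_char_0[where 'a = complex] by simp
qed

text \<open>
  Both sides are the constant term of \<open>p(w) p(1 / w) (1 - w^8)\<close>. For the left-hand side, the
  coefficients of \<open>w^0\<close> and of \<open>w^8\<close> in \<open>(w + 1 / w)^(2 m)\<close> are central and shifted binomial
  coefficients.
\<close>

lemma constant_term_identity:
  fixes p Q :: "complex poly"
  assumes deg: "degree p \<le> n" "degree Q \<le> n"
    and eq: "\<And>w. w \<noteq> 0 \<Longrightarrow> poly Q (w + 1 / w) = poly p w * poly p (1 / w)"
  shows "(\<Sum>m\<le>n. (of_nat (2 * m choose m) - of_nat (2 * m choose (m + 4))) * coeff Q (2 * m))
    = (\<Sum>k\<le>n. coeff p k ^ 2) - (\<Sum>k\<le>n. coeff p k * coeff p (k + 8))"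
proof -
  \<comment> \<open>Multiplication by \<open>w ^ n\<close> turns the Laurent polynomial into the polynomial \<open>W\<close>, and \<open>p(1 / w)\<close> into \<open>R\<close>.\<close>
  define W where "W = (\<Sum>k\<le>n. smult (coeff Q k) (monom 1 (n - k) * [:1, 0, 1:] ^ k))"
  define R where "R = (\<Sum>j\<le>n. monom (coeff p j) (n - j))"
  have expand: "poly q x = (\<Sum>k\<le>n. coeff q k * x ^ k)" if "degree q \<le> n" for q and x :: complex
    unfolding poly_altdef using that by (intro sum.mono_neutral_left) (auto simp: coeff_eq_0)
  have "W = p * R"
  proof (rule poly_eqI_nonzero)
    fix w :: complex assume w: "w \<noteq> 0"
    have "w ^ (n - k) * (1 + w * w) ^ k = w ^ n * (w + 1 / w) ^ k" if "k \<le> n" for k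
    proof -
      have "1 + w * w = w * (w + 1 / w)" using w by (simp add: field_simps)
      then have "(1 + w * w) ^ k = w ^ k * (w + 1 / w) ^ k" by (simp only: power_mult_distrib)
      then show ?thesis using that by (simp flip: power_add mult.assoc)
    qed
    then have "poly W w = w ^ n * poly Q (w + 1 / w)"
      unfolding expand[OF deg(2)]
      by (auto simp: W_def poly_sum poly_monom sum_distrib_left intro!: sum.cong)
    moreover have "poly R w = w ^ n * poly p (1 / w)"
      unfolding expand[OF deg(1)] using w
      by (auto simp: R_def poly_sum poly_monom sum_distrib_left power_diff power_divide intro!: sum.cong)
    ultimately show "poly W w = poly (p * R) w" using eq[OF w] by simp
  qed
  have R: "coeff R i = (if i \<le> n then coeff p (n - i) else 0)" for i
  proof -
    have "coeff R i = (\<Sum>j\<le>n. if j = n - i \<and> i \<le> n then coeff p j else 0)"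
      unfolding R_def by (auto simp: coeff_sum intro!: sum.cong)
    then show ?thesis by (auto simp: sum.delta')
  qed
  have even_part: "(\<Sum>k\<le>n. if even k then c (k div 2) * coeff Q k else 0) = (\<Sum>m\<le>n. c m * coeff Q (2 * m))"
    for c :: "nat \<Rightarrow> complex"
  proof -
    have "(\<Sum>m\<le>n. c m * coeff Q (2 * m)) = (\<Sum>m\<in>{m. 2 * m \<le> n}. c m * coeff Q (2 * m))"
      using deg(2) by (intro sum.mono_neutral_right) (auto intro!: coeff_eq_0)
    also have "\<dots> = (\<Sum>k\<in>{k. k \<le> n \<and> even k}. c (k div 2) * coeff Q k)"
      by (rule sum.reindex_bij_witness[of _ "\<lambda>k. k div 2" "\<lambda>m. 2 * m"]) auto
    also have "\<dots> = (\<Sum>k\<le>n. if even k then c (k div 2) * coeff Q k else 0)"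
      by (simp flip: sum.inter_filter add: atMost_def Collect_conj_eq)
    finally show ?thesis ..
  qed
  have "coeff W n = (\<Sum>k\<le>n. if even k then of_nat (2 * (k div 2) choose (k div 2)) * coeff Q k else 0)"
    unfolding W_def by (auto simp: coeff_sum coeff_monom_mult coeff_one_plus_square_power intro!: sum.cong)
  then have W1: "coeff W n = (\<Sum>m\<le>n. of_nat (2 * m choose m) * coeff Q (2 * m))"
    unfolding even_part[of "\<lambda>m. of_nat (2 * m choose m)"] .
  have "coeff (monom 1 (n - k) * [:1, 0, 1:] ^ k) (n + 8) =
      (if even k then of_nat (2 * (k div 2) choose (k div 2 + 4)) else (0::complex))" if "k \<le> n" for k
  proof -
    have "\<not> n + 8 < n - k" "n + 8 - (n - k) = k + 8" "(k + 8) div 2 = k div 2 + 4" using that by auto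
    then show ?thesis by (simp add: coeff_monom_mult coeff_one_plus_square_power del: div_add_self1 div_add_self2)
  qed
  then have "coeff W (n + 8) = (\<Sum>k\<le>n. if even k then of_nat (2 * (k div 2) choose (k div 2 + 4)) * coeff Q k else 0)"
    unfolding W_def coeff_sum coeff_smult by (intro sum.cong) auto
  then have W2: "coeff W (n + 8) = (\<Sum>m\<le>n. of_nat (2 * m choose (m + 4)) * coeff Q (2 * m))"
    unfolding even_part[of "\<lambda>m. of_nat (2 * m choose (m + 4))"] .
  have W3: "coeff W n = (\<Sum>k\<le>n. coeff p k ^ 2)"
    unfolding \<open>W = p * R\<close> coeff_mult R by (auto simp: power2_eq_square intro!: sum.cong)
  have "coeff W (n + 8) = (\<Sum>i\<in>{8..n + 8}. coeff p i * coeff p (i - 8))"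
    unfolding \<open>W = p * R\<close> coeff_mult R by (intro sum.mono_neutral_cong_right) auto
  also have "\<dots> = (\<Sum>k\<le>n. coeff p k * coeff p (k + 8))"
    by (rule sum.reindex_bij_witness[of _ "\<lambda>k. k + 8" "\<lambda>i. i - 8"]) auto
  finally show ?thesis using W1 W2 W3 by (simp add: left_diff_distrib sum_subtractf)
qed

text \<open>
  In the variable \<open>t = w + 1 / w\<close>, this is \<open>P(y w) P(y / w)\<close> for \<open>P(x) = \<Prod>(x + r)\<close>, because
  \<open>(y w + r) (y / w + r) = y\<^sup>2 + r\<^sup>2 + r y t\<close>.
\<close>

definition joukowski_product :: "complex \<Rightarrow> real list \<Rightarrow> complex poly" where
  "joukowski_product y rs = (\<Prod>r\<leftarrow>rs. [:y\<^sup>2 + (of_real r)\<^sup>2, of_real r * y:])"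

lemma poly_joukowski_product:
  assumes "w \<noteq> 0"
  shows "poly (joukowski_product y rs) (w + 1 / w)
    = poly (\<Prod>r\<leftarrow>rs. [:of_real r, 1:]) (w * y) * poly (\<Prod>r\<leftarrow>rs. [:of_real r, 1:]) (y / w)"
proof (induction rs)
  case Nil
  then show ?case by (simp add: joukowski_product_def)
next
  case (Cons r rs)
  have "(y\<^sup>2 + (of_real r)\<^sup>2) + (w + 1 / w) * (of_real r * y) = (of_real r + w * y) * (of_real r + y / w)"
    using assms by (simp add: field_simps power2_eq_square)
  with Cons show ?case
    by (simp add: joukowski_product_def algebra_simps del: mult_pCons_left)
qed

lemma degree_joukowski_product: "degree (joukowski_product y rs) \<le> length rs"
  unfolding joukowski_product_def by (rule degree_linear_products)

lemma coeff_joukowski_product_holomorphic: "(\<lambda>y. coeff (joukowski_product y rs) k) holomorphic_on S"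
  unfolding joukowski_product_def
proof (induction rs arbitrary: k)
  case Nil
  then show ?case by simp
next
  case (Cons r rs)
  then show ?case by (cases k) (auto intro!: holomorphic_intros)
qed

text \<open>
  A factor of the product vanishes at \<open>t = - (y / r + r / y)\<close>, and \<open>y\<close> and \<open>1 / y\<close> lie in the
  same open half-plane.
\<close>

lemma joukowski_product_nonvanishing:
  fixes rs :: "real list"
  assumes y: "Re y > 0" and t: "Re t \<ge> 0" and rs: "\<And>r. r \<in> set rs \<Longrightarrow> r \<ge> 0"
  shows "poly (joukowski_product y rs) t \<noteq> 0"
  unfolding joukowski_product_def using rs
proof (induction rs)
  case (Cons r rs)
  have y0: "y \<noteq> 0" using y by auto
  have "y\<^sup>2 + (of_real r)\<^sup>2 + t * (of_real r * y) \<noteq> 0"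
  proof
    assume 0: "y\<^sup>2 + (of_real r)\<^sup>2 + t * (of_real r * y) = 0"
    define v where "v = 1 / y"
    have "y * (y + of_real (r\<^sup>2) * v + of_real r * t) = y\<^sup>2 + of_real (r\<^sup>2) * (y * v) + t * (of_real r * y)"
      by (simp add: algebra_simps power2_eq_square)
    also have "y * v = 1" using y0 by (simp add: v_def)
    finally have "y * (y + of_real (r\<^sup>2) * v + of_real r * t) = 0" using 0 by simp
    then have "Re (y + of_real (r\<^sup>2) * v + of_real r * t) = 0" using y0 by (simp only: mult_eq_0_iff) simp
    moreover have "Re v > 0"
      using y by (auto simp: v_def Re_divide intro!: divide_pos_pos add_pos_nonneg)
    then have "Re y + r\<^sup>2 * Re v + r * Re t > 0"
      using y t Cons.prems[of r] by (intro add_pos_nonneg) auto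
    ultimately show False by (simp flip: of_real_power)
  qed
  with Cons show ?case by (simp del: mult_pCons_left)
qed simp

lemma degree_S_op_le: "r > 0 \<Longrightarrow> degree (S_op r p) \<le> degree p"
  by (intro degree_le) (auto simp: coeff_S_op coeff_eq_0 icoeff_def nat_add_distrib)

lemma lead_coeff_S_op:
  assumes "r > 0"
  shows "lead_coeff (S_op r p) = (lead_coeff p)\<^sup>2"
proof -
  have top: "coeff (S_op r p) (degree p) = (lead_coeff p)\<^sup>2"
    using assms by (simp add: coeff_S_op icoeff_def nat_add_distrib coeff_eq_0)
  show ?thesis
  proof (cases "p = 0")
    case True
    then show ?thesis using assms by (simp add: coeff_S_op icoeff_def)
  next
    case False
    then have "degree p \<le> degree (S_op r p)" by (intro le_degree) (simp add: top)
    then show ?thesis using degree_S_op_le[OF assms, of p] top by simp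
  qed
qed

lemma S_op_4_as_constant_term:
  fixes p :: "real poly" and c y :: complex and rs :: "real list"
  defines "Q \<equiv> smult (c\<^sup>2) (joukowski_product y rs)"
  assumes p: "map_poly of_real p = smult c (\<Prod>r\<leftarrow>rs. [:of_real r, 1:])" and n: "length rs = degree p"
  shows "(\<Sum>m\<le>degree p. (of_nat (2 * m choose m) - of_nat (2 * m choose (m + 4))) * coeff Q (2 * m))
    = cpoly (S_op 4 p) (y\<^sup>2)"
proof -
  define n where "n = degree p"
  define P where "P = pcompose (map_poly of_real p) [:0, y:]"
  have coeff_P: "coeff P k = of_real (coeff p k) * y ^ k" for k
  proof -
    have "P = (\<Sum>i\<le>n. monom (of_real (coeff p i) * y ^ i) i)"
      by (intro poly_eqI_nonzero)
        (simp add: P_def poly_pcompose poly_altdef[of "map_poly of_real p"] degree_map_poly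
          coeff_map_poly n_def poly_sum poly_monom power_mult_distrib mult_ac)
    then show ?thesis by (auto simp: coeff_sum n_def coeff_eq_0)
  qed
  have "degree P \<le> n" by (intro degree_le) (auto simp: coeff_P n_def coeff_eq_0)
  moreover have "degree Q \<le> n"
    unfolding Q_def n_def n[symmetric]
    by (rule order.trans[OF degree_smult_le degree_joukowski_product])
  moreover have "poly Q (w + 1 / w) = poly P w * poly P (1 / w)" if "w \<noteq> 0" for w
    using poly_joukowski_product[OF that, of y rs]
    by (simp add: Q_def P_def p poly_pcompose power2_eq_square mult_ac)
  ultimately have "(\<Sum>m\<le>n. (of_nat (2 * m choose m) - of_nat (2 * m choose (m + 4))) * coeff Q (2 * m))
    = (\<Sum>k\<le>n. coeff P k ^ 2) - (\<Sum>k\<le>n. coeff P k * coeff P (k + 8))"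
    by (rule constant_term_identity)
  also have "(\<Sum>k\<le>n. coeff P k * coeff P (k + 8))
      = (\<Sum>k\<le>n. of_real (coeff p k * coeff p (k + 8)) * (y\<^sup>2) ^ (k + 4))"
  proof (intro sum.cong refl)
    fix k
    have "(y\<^sup>2) ^ (k + 4) = y ^ k * y ^ (k + 8)"
      unfolding power_mult[symmetric] power_add[symmetric] by (rule arg_cong) simp
    then show "coeff P k * coeff P (k + 8) = of_real (coeff p k * coeff p (k + 8)) * (y\<^sup>2) ^ (k + 4)"
      by (simp only: coeff_P of_real_mult mult_ac)
  qed
  also have "\<dots> = (\<Sum>k\<in>{4..n+4}. of_real (coeff p (k - 4) * coeff p (k + 4)) * (y\<^sup>2) ^ k)"
    by (rule sum.reindex_bij_witness[of _ "\<lambda>k. k - 4" "\<lambda>k. k + 4"]) (auto simp: add.commute)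
  also have "\<dots> = (\<Sum>k\<le>n. of_real (icoeff p (int k - 4) * icoeff p (int k + 4)) * (y\<^sup>2) ^ k)"
    by (intro sum.mono_neutral_cong)
      (auto simp: icoeff_def n_def nat_diff_distrib nat_add_distrib coeff_eq_0)
  also have "(\<Sum>k\<le>n. coeff P k ^ 2) - \<dots> = (\<Sum>k\<le>n. of_real (coeff (S_op 4 p) k) * (y\<^sup>2) ^ k)"
    by (simp add: coeff_S_op coeff_P power_mult_distrib algebra_simps sum_subtractf flip: power_mult)
  also have "\<dots> = cpoly (S_op 4 p) (y\<^sup>2)"
  proof -
    have "degree (S_op 4 p) \<le> n"
      unfolding n_def by (intro degree_S_op_le) simp
    then show ?thesis unfolding poly_altdef
      by (intro sum.mono_neutral_cong_right) (auto simp: degree_map_poly coeff_map_poly coeff_eq_0)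
  qed
  finally show ?thesis by (simp add: n_def)
qed

section \<open>Preservation of real zeros\<close>

text \<open>
  Hurwitz's theorem applies to \<open>3 T(y\<^sup>2)\<close> as a limit of nonvanishing pairings, where \<open>T\<close> is
  the image of \<open>p\<close>. It leaves open that the limit is constant; the constant is not 0 because
  the leading coefficient of \<open>T\<close> is a square.
\<close>

lemma S_op_4_nonvanishing:
  assumes p: "\<And>k. coeff p k \<ge> 0" "only_real_zeros p" "p \<noteq> 0" and y: "Re y > 0"
  shows "cpoly (S_op 4 p) (y\<^sup>2) \<noteq> 0"
proof -
  define T where "T = S_op 4 p"
  define n where "n = degree p"
  define H where "H = {y::complex. Re y > 0}"
  obtain rs where rs: "p = smult (lead_coeff p) (\<Prod>r\<leftarrow>rs. [:r, 1:])" "length rs = degree p"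
      "\<forall>r\<in>set rs. poly p (- r) = 0"
    using factor_over_reals[OF p(2)] by blast
  have rs0: "r \<ge> 0" if "r \<in> set rs" for r
  proof (rule ccontr)
    assume r: "\<not> r \<ge> 0"
    have "lead_coeff p > 0" using p(1)[of "degree p"] p(3) by (simp add: order_less_le)
    with r have "poly p (- r) > 0"
      unfolding poly_altdef using p(1) by (intro sum_pos2[of _ "degree p"]) auto
    with rs(3) that show False by simp
  qed
  define c where "c = complex_of_real (lead_coeff p)"
  have c: "c \<noteq> 0" using p(3) by (simp add: c_def)
  have cp: "map_poly of_real p = smult c (\<Prod>r\<leftarrow>rs. [:complex_of_real r, 1:])"
  proof -
    have "map_poly of_real p = smult c (map_poly complex_of_real (\<Prod>r\<leftarrow>rs. [:r, 1:]))"
      by (subst rs(1)) (simp only: c_def poly_eq_iff coeff_smult coeff_map_poly of_real_mult of_real_0 simp_thms)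
    then show ?thesis by (simp add: of_real_linear_products)
  qed
  define Q where "Q y = smult (c\<^sup>2) (joukowski_product y rs)" for y
  have deg: "degree (Q y) \<le> n" for y
    unfolding Q_def n_def rs(2)[symmetric]
    by (rule order.trans[OF degree_smult_le degree_joukowski_product])
  have hol: "(\<lambda>y. coeff (Q y) k) holomorphic_on S" for k S
    unfolding Q_def coeff_smult by (intro holomorphic_intros coeff_joukowski_product_holomorphic)
  obtain us where us: "\<And>N u. u \<in> set (us N) \<Longrightarrow> 0 < u \<and> u \<le> 2 / 27"
      "\<And>N. (\<Sum>u\<leftarrow>us N. u) = 1 / 5"
      "\<And>N m. coeff (\<Prod>u\<leftarrow>us N. [:1, u:]) m = laguerre_coeff (N + 200) m"
    using laguerre_reciprocal_zeros[OF le_add2] by metis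
  define g where "g N = (\<Prod>u\<leftarrow>us N. [:1, complex_of_real u:])" for N
  have g: "coeff (g N) m = of_real (laguerre_coeff (N + 200) m)" for N m
    using us(3)[of N m] of_real_linear_products[of "\<lambda>_. 1" "\<lambda>u. u" "us N"]
    by (metis coeff_cpoly g_def of_real_1)
  define \<Phi> where "\<Phi> N y = even_pairing n (reduced_operator (g N)) (Q y)" for N y
  have "T \<noteq> 0"
    using p(3) lead_coeff_S_op[of 4 p] by (auto simp: T_def)
  have \<Phi>_nz: "\<Phi> N y \<noteq> 0" if "y \<in> H" for N y
    unfolding \<Phi>_def
  proof (rule even_pairing_nonzero)
    have "coeff (reduced_operator (g N)) 0 = 3"
      by (simp add: reduced_operator_def g laguerre_coeff_def fact_numeral coeff_mult)
    then show "reduced_operator (g N) \<noteq> 0" by auto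
    show "Im z = 0 \<and> Re z < 0" if "poly (reduced_operator (g N)) z = 0" for z
      using reduced_operator_zeros[of "us N" z] us(1,2) that unfolding g_def by blast
    show "degree (Q y) \<le> n" by (rule deg)
    show "poly (Q y) t \<noteq> 0" if "Re t \<ge> 0" for t
      using joukowski_product_nonvanishing[OF _ that rs0] \<open>y \<in> H\<close> c by (simp add: Q_def H_def)
  qed
  have lim: "uniform_limit K \<Phi> (\<lambda>y. 3 * cpoly T (y\<^sup>2)) sequentially" if K: "compact K" for K
  proof -
    have "(\<lambda>N. coeff (reduced_operator (g N)) m * fact (2 * m))
        \<longlonglongrightarrow> 3 * (of_nat (2 * m choose m) - of_nat (2 * m choose (m + 4)))" for m
      by (intro reduced_operator_coeff_tendsto)
        (unfold g, intro tendsto_of_real LIMSEQ_ignore_initial_segment laguerre_coeff_tendsto)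
    then have "uniform_limit K
        (\<lambda>N y. \<Sum>m\<le>n. coeff (reduced_operator (g N)) m * fact (2 * m) * coeff (Q y) (2 * m))
        (\<lambda>y. \<Sum>m\<le>n. 3 * (of_nat (2 * m choose m) - of_nat (2 * m choose (m + 4))) * coeff (Q y) (2 * m))
        sequentially"
      by (intro uniform_limit_linear_combination K holomorphic_on_imp_continuous_on hol)
    moreover have "(\<Sum>m\<le>n. 3 * (of_nat (2 * m choose m) - of_nat (2 * m choose (m + 4))) * coeff (Q y) (2 * m))
        = 3 * cpoly T (y\<^sup>2)" for y
      by (simp only: T_def n_def Q_def mult.assoc[of 3] sum_distrib_left[symmetric]
          S_op_4_as_constant_term[OF cp rs(2)])
    ultimately show ?thesis by (simp add: \<Phi>_def[abs_def] even_pairing_def)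
  qed
  have inj: "\<exists>y\<in>H. cpoly T (y\<^sup>2) \<noteq> 0"
  proof (rule ccontr)
    assume *: "\<not> ?thesis"
    have "of_nat (Suc k) \<in> {x. cpoly T x = 0}" for k
    proof -
      have "(complex_of_real (sqrt (real (Suc k))))\<^sup>2 = of_nat (Suc k)"
        by (simp flip: of_real_power del: of_nat_Suc)
      moreover have "complex_of_real (sqrt (real (Suc k))) \<in> H" by (simp add: H_def)
      ultimately show ?thesis using * by fastforce
    qed
    then have "range (\<lambda>k. of_nat (Suc k)) \<subseteq> {x. cpoly T x = 0}" by blast
    moreover have "infinite (range (\<lambda>k. complex_of_nat (Suc k)))"
      by (rule range_inj_infinite) (auto simp: inj_def simp del: of_nat_Suc)
    ultimately have "map_poly complex_of_real T = 0"
      using poly_roots_finite infinite_super by blast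
    with \<open>T \<noteq> 0\<close> show False by (simp add: map_poly_eq_0_iff)
  qed
  have "3 * cpoly T (y\<^sup>2) \<noteq> 0"
  proof (cases "(\<lambda>y. 3 * cpoly T (y\<^sup>2)) constant_on H")
    case True
    with inj y show ?thesis unfolding constant_on_def H_def by force
  next
    case False
    show ?thesis
    proof (rule Hurwitz_no_zeros[where S = H and \<F> = \<Phi> and g = "\<lambda>y. 3 * cpoly T (y\<^sup>2)"])
      show "open H" "connected H"
        unfolding H_def by (simp_all add: open_halfspace_Re_gt convex_halfspace_Re_gt convex_connected)
      show "\<Phi> N holomorphic_on H" for N
        unfolding \<Phi>_def even_pairing_def by (intro holomorphic_intros hol)
    qed (use lim False \<Phi>_nz y in \<open>auto simp: H_def intro!: holomorphic_intros\<close>)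
  qed
  then show ?thesis by (simp add: T_def)
qed

theorem proposition11:
  shows "S_op 4 ` Laguerre_Polya_plus_poly \<subseteq> Laguerre_Polya_plus_poly \<union> {0}"
proof
  fix T assume "T \<in> S_op 4 ` Laguerre_Polya_plus_poly"
  then obtain p where T: "T = S_op 4 p" and "p \<in> Laguerre_Polya_plus_poly" by blast
  then consider "p = 0" | "\<And>k. coeff p k \<ge> 0" "only_real_zeros p" "p \<noteq> 0"
    by (auto simp: Laguerre_Polya_plus_poly_eq)
  then show "T \<in> Laguerre_Polya_plus_poly \<union> {0}"
  proof cases
    case 1
    then have "T = 0" by (simp add: T poly_eq_iff coeff_S_op icoeff_def)
    then show ?thesis by simp
  next
    case 2
    \<comment> \<open>Every number outside the nonpositive half-line has a square root in the open right half-plane.\<close>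
    have neg: "x \<in> \<real>\<^sub>\<le>\<^sub>0" if "cpoly T x = 0" for x
    proof (rule ccontr)
      assume "x \<notin> \<real>\<^sub>\<le>\<^sub>0"
      then have "Re (csqrt x) > 0"
      proof -
        have "Re (csqrt x) \<noteq> 0"
        proof
          assume "Re (csqrt x) = 0"
          then have "(csqrt x)\<^sup>2 = of_real (- (Im (csqrt x))\<^sup>2)"
            by (simp add: complex_eq_iff power2_eq_square del: power2_csqrt)
          then have "x = of_real (- (Im (csqrt x))\<^sup>2)" by simp
          then have "x \<in> \<real>\<^sub>\<le>\<^sub>0" by (metis nonpos_Reals_of_real_iff neg_le_0_iff_le zero_le_power2)
          with \<open>x \<notin> \<real>\<^sub>\<le>\<^sub>0\<close> show False ..
        qed
        with Re_csqrt[of x] show ?thesis by linarith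
      qed
      from S_op_4_nonvanishing[OF 2 this] that show False by (simp add: T)
    qed
    then have real: "only_real_zeros T"
      unfolding only_real_zeros_def by (fastforce elim!: nonpos_Reals_cases)
    obtain rs where rs: "T = smult (lead_coeff T) (\<Prod>r\<leftarrow>rs. [:r, 1:])" "\<forall>r\<in>set rs. poly T (- r) = 0"
      using factor_over_reals[OF real] by blast
    have "r \<ge> 0" if "r \<in> set rs" for r
      using neg[of "of_real (- r)"] rs(2) that by (simp add: cpoly_of_real del: of_real_minus)
    then have "coeff (\<Prod>r\<leftarrow>rs. [:r, 1:]) k \<ge> 0" for k
    proof (induction rs arbitrary: k)
      case (Cons r rs)
      then show ?case by (cases k) auto
    qed (auto simp: coeff_1)
    moreover have "lead_coeff T > 0"
      using 2(3) by (simp add: T lead_coeff_S_op)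
    ultimately have "coeff T k \<ge> 0" for k
      by (subst rs(1)) simp
    with real show ?thesis by (auto simp: Laguerre_Polya_plus_poly_eq)
  qed
qed

end
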